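(* Let $m\ge 1$. Let $h^u$ and $\tilde h^u$ be two step-up procedures with threshold functions $\tau^u_\alpha$ and $\tilde\tau^u_\alpha$, each satisfying the threshold condition: (1) the threshold function at $i$ is non-decreasing in $i$ for each fixed $\alpha$; (2) the threshold function at $i$ is continuous in $\alpha$ and non-decreasing in $\alpha$ for each fixed $i$. Then the intersection $h^u\cap\tilde h^u$, which is characterised as a step-up procedure by the threshold function $\tau_\alpha(i)=\min(\tau^u_\alpha(i),\tilde\tau^u_\alpha(i))$, also satisfies the threshold condition, i.e. $\tau_\alpha$ satisfies (1) and (2).
   Context: For $p\in[0,1]^m$ let $p_{(1)}\le\cdots\le p_{(m)}$ be its ordered entries. A threshold function is a family of maps $\tau_\alpha:\{1,\ldots,m\}\to[0,1]$, $\alpha\in[0,1]$. The step-up procedure with threshold function $\tau_\alpha$ sends $(p,\alpha)\in[0,1]^m\times[0,1]$ to the set $\{i\in\{1,\ldots,m\}: p_i\le\max\{p_{(j)}: p_{(j)}\le\tau_\alpha(j)\}\}$ of indices of rejected hypotheses (maximum over the empty set equal to $-\infty$, i.e. no rejections). The intersection of two procedures is $(h_1\cap h_2)(p,\alpha)=h_1(p,\alpha)\cap h_2(p,\alpha)$; the intersection of two step-up procedures is represented by the pointwise minimum of their threshold functions. A step-up procedure is said to satisfy the threshold condition if its threshold function does.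
   Formalization: The clause that the intersection is characterised as a step-up procedure by the pointwise minimum is false in general, e.g. m=2, thresholds (1/20,1/5) and (1/10,3/20), p=(1/10,1/5); it is replaced by: the step-up procedure of the minimum is contained in the intersection. *)

theory Defs
  imports "HOL-Analysis.Analysis" "HOL-Library.FuncSet"
begin

(* A p-value vector is a function p restricted to the indices 1, ..., m.
   A procedure maps such a vector and a level alpha to a set of rejected indices. *)
type_synonym procedure = "(nat \<Rightarrow> real) \<Rightarrow> real \<Rightarrow> nat set"

definition unit_cube :: "nat \<Rightarrow> (nat \<Rightarrow> real) set" where
  "unit_cube m = {1..m} \<rightarrow> {0..1}"

text \<open>The order statistic \<open>p\<^sub>(\<^sub>j\<^sub>)\<close>, for \<open>1 \<le> j \<le> m\<close>.\<close>
definition ordered_entry :: "nat \<Rightarrow> (nat \<Rightarrow> real) \<Rightarrow> nat \<Rightarrow> real" where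
  "ordered_entry m p j = sort (map p [1..<Suc m]) ! (j - 1)"

definition threshold_function :: "nat \<Rightarrow> (real \<Rightarrow> nat \<Rightarrow> real) \<Rightarrow> bool" where
  "threshold_function m \<tau> \<longleftrightarrow> (\<forall>\<alpha>\<in>{0..1}. \<tau> \<alpha> \<in> {1..m} \<rightarrow> {0..1})"

text \<open>The nonemptiness conjunct encodes that the maximum of the empty set is \<open>-\<infinity>\<close>.\<close>
definition step_up :: "nat \<Rightarrow> (real \<Rightarrow> nat \<Rightarrow> real) \<Rightarrow> procedure" where
  "step_up m \<tau> p \<alpha> =
     (let S = {ordered_entry m p j | j. j \<in> {1..m} \<and> ordered_entry m p j \<le> \<tau> \<alpha> j}
      in {i \<in> {1..m}. S \<noteq> {} \<and> p i \<le> Max S})"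

definition inter_procedure :: "procedure \<Rightarrow> procedure \<Rightarrow> procedure" where
  "inter_procedure h1 h2 p \<alpha> = h1 p \<alpha> \<inter> h2 p \<alpha>"

definition min_threshold ::
    "(real \<Rightarrow> nat \<Rightarrow> real) \<Rightarrow> (real \<Rightarrow> nat \<Rightarrow> real) \<Rightarrow> real \<Rightarrow> nat \<Rightarrow> real" where
  "min_threshold \<tau> \<tau>' \<alpha> i = min (\<tau> \<alpha> i) (\<tau>' \<alpha> i)"

text \<open>A step-up procedure satisfies the threshold condition if its threshold function does; the
  condition is attached to the threshold function, because different threshold functions may
  induce the same procedure.\<close>
definition threshold_condition :: "nat \<Rightarrow> (real \<Rightarrow> nat \<Rightarrow> real) \<Rightarrow> bool" where
  "threshold_condition m \<tau> \<longleftrightarrow>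
     (\<forall>\<alpha>\<in>{0..1}. mono_on {1..m} (\<tau> \<alpha>)) \<and>
     (\<forall>i\<in>{1..m}. continuous_on {0..1} (\<lambda>\<alpha>. \<tau> \<alpha> i) \<and> mono_on {0..1} (\<lambda>\<alpha>. \<tau> \<alpha> i))"

text \<open>The step-up procedure of the pointwise minimum is always contained in the intersection of
  the two step-up procedures, but in general it does not equal it. The following example shows
  that the intersection need not be induced by any threshold function at all, even if both
  procedures satisfy the threshold condition.\<close>
lemma inter_step_up_not_step_up:
  fixes \<tau> \<tau>' :: "real \<Rightarrow> nat \<Rightarrow> real"
  defines "\<tau> \<equiv> (\<lambda>\<alpha> i. if i \<le> 1 then 1/20 else 1/5)"
    and "\<tau>' \<equiv> (\<lambda>\<alpha> i. if i \<le> 1 then 1/10 else 3/20)"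
  shows "threshold_function 2 \<tau> \<and> threshold_condition 2 \<tau> \<and>
         threshold_function 2 \<tau>' \<and> threshold_condition 2 \<tau>' \<and>
         (\<nexists>\<sigma>. \<forall>p\<in>unit_cube 2. \<forall>\<alpha>\<in>{0..1}.
            inter_procedure (step_up 2 \<tau>) (step_up 2 \<tau>') p \<alpha> = step_up 2 \<sigma> p \<alpha>)"
proof -
  define p :: "real \<Rightarrow> nat \<Rightarrow> real" where "p = (\<lambda>x i. if i \<le> 1 then 1/10 else x)"
  have I: "{1..2} = {1, 2::nat}" by auto
  have oe: "ordered_entry 2 (p x) 1 = 1/10" "ordered_entry 2 (p x) 2 = x" if "x > 1/10" for x
    using that by (simp_all add: ordered_entry_def p_def upt_rec)
  have set_eq: "{ordered_entry 2 (p x) j | j. j \<in> {1..2} \<and> ordered_entry 2 (p x) j \<le> f \<alpha> j} =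
      (if 1/10 \<le> f \<alpha> 1 then {1/10} else {}) \<union> (if x \<le> f \<alpha> 2 then {x} else {})"
    if "x > 1/10" for x \<alpha> :: real and f :: "real \<Rightarrow> nat \<Rightarrow> real"
  proof -
    have "{F j | j. j \<in> {1, 2} \<and> Q j} = (if Q 1 then {F 1} else {}) \<union> (if Q 2 then {F 2} else {})"
      for F :: "nat \<Rightarrow> real" and Q :: "nat \<Rightarrow> bool"
      by auto
    from this[of "ordered_entry 2 (p x)" "\<lambda>j. ordered_entry 2 (p x) j \<le> f \<alpha> j",
        unfolded oe[OF that]]
    show ?thesis unfolding I .
  qed
  have thr: "threshold_function 2 \<tau>" "threshold_function 2 \<tau>'"
      "threshold_condition 2 \<tau>" "threshold_condition 2 \<tau>'"
    by (auto simp: threshold_function_def threshold_condition_def \<tau>_def \<tau>'_def mono_on_def)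
  have cube: "p x \<in> unit_cube 2" if "x \<in> {0..1}" for x
    using that by (auto simp: unit_cube_def p_def)
  have eval: "step_up 2 f (p x) \<alpha> =
      (if x \<le> f \<alpha> 2 then {1, 2} else if 1/10 \<le> f \<alpha> 1 then {1} else {})"
    if "x > 1/10" for x \<alpha> :: real and f :: "real \<Rightarrow> nat \<Rightarrow> real"
    unfolding step_up_def Let_def set_eq[OF that] unfolding I using that by (auto simp: p_def)
  have 1: "inter_procedure (step_up 2 \<tau>) (step_up 2 \<tau>') (p (1/5)) 0 = {1}"
    by (simp add: inter_procedure_def eval \<tau>_def \<tau>'_def)
  have 2: "inter_procedure (step_up 2 \<tau>) (step_up 2 \<tau>') (p (1/4)) 0 = {}"
    by (simp add: inter_procedure_def eval \<tau>_def \<tau>'_def)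
  have False
    if \<sigma>: "\<forall>p\<in>unit_cube 2. \<forall>\<alpha>\<in>{0..1}.
       inter_procedure (step_up 2 \<tau>) (step_up 2 \<tau>') p \<alpha> = step_up 2 \<sigma> p \<alpha>" for \<sigma>
  proof -
    have "step_up 2 \<sigma> (p (1/5)) 0 = {1}" "step_up 2 \<sigma> (p (1/4)) 0 = {}"
      using \<sigma> cube[of "1/5"] cube[of "1/4"] 1 2 by auto
    then show False
      by (auto simp: eval split: if_splits)
  qed
  then show ?thesis using thr by blast
qed

end

theory Submission
  imports Defs
begin

text \<open>Taking the minimum of two functions preserves values in [0,1], monotonicity and
  continuity, so each clause of the threshold condition passes to \<open>min_threshold\<close>
  separately. Its link to the intersection is an inclusion: by \<open>step_up_mono\<close> smaller
  thresholds reject less, and the minimum lies below both thresholds. Equality is not claimed, since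
  \<open>inter_step_up_not_step_up\<close> refutes it in general.\<close>

text \<open>Raising the thresholds can only add order statistics to the set whose maximum is the
  rejection cutoff.\<close>

lemma step_up_mono:
  assumes "\<And>j. j \<in> {1..m} \<Longrightarrow> \<sigma> \<alpha> j \<le> \<tau> \<alpha> j"
  shows "step_up m \<sigma> p \<alpha> \<subseteq> step_up m \<tau> p \<alpha>"
proof -
  define S where
    "S \<rho> = {ordered_entry m p j | j. j \<in> {1..m} \<and> ordered_entry m p j \<le> \<rho> \<alpha> j}"
    for \<rho> :: "real \<Rightarrow> nat \<Rightarrow> real"
  have step_up_S: "step_up m \<rho> p \<alpha> = {i \<in> {1..m}. S \<rho> \<noteq> {} \<and> p i \<le> Max (S \<rho>)}" for \<rho>
    by (simp add: step_up_def S_def)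
  \<comment> \<open>\<open>Max\<close> is meaningful only on finite nonempty sets, so finiteness
    comes first.\<close>
  have "S \<tau> \<subseteq> ordered_entry m p ` {1..m}"
    by (auto simp: S_def)
  then have fin: "finite (S \<tau>)"
    by (rule finite_subset) simp
  have sub: "S \<sigma> \<subseteq> S \<tau>"
    using assms by (fastforce simp: S_def intro: order_trans)
  \<comment> \<open>If \<open>S \<sigma>\<close> is empty, the smaller procedure rejects nothing and
    the inclusion is trivial.\<close>
  then have "Max (S \<sigma>) \<le> Max (S \<tau>)" if "S \<sigma> \<noteq> {}"
    using that fin by (rule Max_mono)
  with sub show ?thesis
    unfolding step_up_S by fastforce
qed

lemma threshold_function_min:
  assumes "threshold_function m \<tau>" and "threshold_function m \<tau>'"
  shows "threshold_function m (min_threshold \<tau> \<tau>')"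
  using assms by (fastforce simp: threshold_function_def min_threshold_def min_def Pi_iff)

text \<open>The types are general because this serves both for indices in \<open>{1..m}\<close> and
  for levels in \<open>{0..1}\<close>.\<close>

lemma mono_on_min:
  fixes f g :: "'a::order \<Rightarrow> 'b::linorder"
  assumes "mono_on A f" and "mono_on A g"
  shows "mono_on A (\<lambda>x. min (f x) (g x))"
  using assms unfolding mono_on_def by (blast intro: min.mono)

lemma threshold_condition_min:
  assumes "threshold_condition m \<tau>" and "threshold_condition m \<tau>'"
  shows "threshold_condition m (min_threshold \<tau> \<tau>')"
  using assms
  \<comment> \<open>Monotonicity in the index concerns
    \<open>min_threshold \<tau> \<tau>' \<alpha>\<close> without its last argument, hence
    \<open>abs_def\<close>.\<close>
  by (auto simp: threshold_condition_def min_threshold_def[abs_def]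
      intro!: mono_on_min continuous_on_min)

theorem lemma4:
  fixes m :: nat and \<tau> \<tau>' :: "real \<Rightarrow> nat \<Rightarrow> real"
  assumes "1 \<le> m"
    and "threshold_function m \<tau>" and "threshold_function m \<tau>'"
    and "threshold_condition m \<tau>" and "threshold_condition m \<tau>'"
  shows "threshold_function m (min_threshold \<tau> \<tau>') \<and>
         threshold_condition m (min_threshold \<tau> \<tau>') \<and>
         (\<forall>p\<in>unit_cube m. \<forall>\<alpha>\<in>{0..1}. step_up m (min_threshold \<tau> \<tau>') p \<alpha>
            \<subseteq> inter_procedure (step_up m \<tau>) (step_up m \<tau>') p \<alpha>)"
proof (intro conjI ballI)
  show "threshold_function m (min_threshold \<tau> \<tau>')"
    using assms(2,3) by (rule threshold_function_min)
  show "threshold_condition m (min_threshold \<tau> \<tau>')"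
    using assms(4,5) by (rule threshold_condition_min)
  show "step_up m (min_threshold \<tau> \<tau>') p \<alpha>
      \<subseteq> inter_procedure (step_up m \<tau>) (step_up m \<tau>') p \<alpha>" for p \<alpha>
    unfolding inter_procedure_def
    by (intro Int_greatest step_up_mono) (simp_all add: min_threshold_def)
qed

end
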